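(* Let $m>1$ be real. For any $m$-spiral with first square of side length $L>0$ and center $(X_0,Y_0)$, the pole $(X_{eye},Y_{eye})$ is located at $$X_{eye}=X_{ur}+L\,\frac{m-1}{m^2+1}=X_{lr}+L\,\frac{m-1}{m^2+1},\qquad Y_{eye}=Y_{ur}-L\,\frac{m+1}{m^2+1}=Y_{lr}+L\,\frac{m(m-1)}{m^2+1},$$ where $(X_{ur},Y_{ur})$ and $(X_{lr},Y_{lr})$ are the upper right and lower right vertices of the first square.
   Context: Let $m>1$ be real, $L>0$ and $(X_0,Y_0)\in\mathbb{R}^2$. The $m$-spiral (generalized whirling square spiral) with first square of side $L$ centered at $(X_0,Y_0)$ is given by a sequence of axis-parallel squares, the $i$-th square ($i\ge 0$) having side length $L_i=L/m^i$ and center $(X_i,Y_i)$, where the centers are placed clockwise by the recursion $$\begin{aligned} i\equiv 0 \pmod 4:&\quad X_{i+1}=X_i+\tfrac{L_i}{2}+\tfrac{L_i}{2m},\quad Y_{i+1}=Y_i+\tfrac{L_i}{2}-\tfrac{L_i}{2m};\\ i\equiv 1 \pmod 4:&\quad X_{i+1}=X_i+\tfrac{L_i}{2}-\tfrac{L_i}{2m},\quad Y_{i+1}=Y_i-\tfrac{L_i}{2}-\tfrac{L_i}{2m};\\ i\equiv 2 \pmod 4:&\quad X_{i+1}=X_i-\tfrac{L_i}{2}-\tfrac{L_i}{2m},\quad Y_{i+1}=Y_i-\tfrac{L_i}{2}+\tfrac{L_i}{2m};\\ i\equiv 3 \pmod 4:&\quad X_{i+1}=X_i-\tfrac{L_i}{2}+\tfrac{L_i}{2m},\quad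 Y_{i+1}=Y_i+\tfrac{L_i}{2}+\tfrac{L_i}{2m}.\end{aligned}$$ The pole $(X_{eye},Y_{eye})$ of the $m$-spiral is the limit of the square centers $(X_i,Y_i)$ as $i\to\infty$. The upper right and lower right vertices of the first square are $(X_{ur},Y_{ur})=(X_0+\frac L2,Y_0+\frac L2)$ and $(X_{lr},Y_{lr})=(X_0+\frac L2,Y_0-\frac L2)$. *)

theory Defs
  imports "HOL-Analysis.Analysis"
begin

text \<open>An axis-parallel square in the plane, given by its center and its side length.\<close>

datatype square = Square (center: "real \<times> real") (side: real)

definition upper_right :: "square \<Rightarrow> real \<times> real" where
  "upper_right S = (fst (center S) + side S / 2, snd (center S) + side S / 2)"

definition lower_right :: "square \<Rightarrow> real \<times> real" where
  "lower_right S = (fst (center S) + side S / 2, snd (center S) - side S / 2)"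

definition spiral_side :: "real \<Rightarrow> real \<Rightarrow> nat \<Rightarrow> real" where
  "spiral_side m L i = L / m ^ i"

primrec spiral_center :: "real \<Rightarrow> real \<Rightarrow> real \<times> real \<Rightarrow> nat \<Rightarrow> real \<times> real" where
  "spiral_center m L P 0 = P"
| "spiral_center m L P (Suc i) =
     (let X = fst (spiral_center m L P i); Y = snd (spiral_center m L P i);
          l = spiral_side m L i
      in if i mod 4 = 0 then (X + l / 2 + l / (2 * m), Y + l / 2 - l / (2 * m))
         else if i mod 4 = 1 then (X + l / 2 - l / (2 * m), Y - l / 2 - l / (2 * m))
         else if i mod 4 = 2 then (X - l / 2 - l / (2 * m), Y - l / 2 + l / (2 * m))
         else (X - l / 2 + l / (2 * m), Y + l / 2 + l / (2 * m)))"

definition spiral :: "real \<Rightarrow> real \<Rightarrow> real \<times> real \<Rightarrow> nat \<Rightarrow> square" where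
  "spiral m L P i = Square (spiral_center m L P i) (spiral_side m L i)"

text \<open>\<^const>\<open>lim\<close> is only meaningful for convergent sequences, so statements about the pole
  should also assert the convergence of the centers.\<close>

definition pole :: "(nat \<Rightarrow> square) \<Rightarrow> real \<times> real" where
  "pole S = lim (\<lambda>i. center (S i))"

end

theory Submission
  imports Defs
begin

text \<open>The spiral is self-similar: passing from one square to the next is the similarity that turns
  clockwise by a right angle and shrinks by the factor \<open>m\<close>. So the steps between consecutive
  centers are the vectors \<open>(L / m ^ i) *\<^sub>R R\<^sup>i s\<close>, where \<open>R\<close> is the clockwise
  quarter turn and \<open>s\<close> is the first step for a unit square (\<open>unit_step\<close>; lemma \<open>spiral_center_Suc\<close>).
  Let \<open>w\<close> (\<open>pole_offset\<close>) be the vector with \<open>w = s + (1 / m) *\<^sub>R R w\<close>, that is, the sum of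
  the geometric series of the operator \<open>(1 / m) *\<^sub>R R\<close> applied to \<open>s\<close>. Then the sums of the
  steps telescope: if \<open>P\<close> is the first center and \<open>L\<close> the first side, the \<open>i\<close>-th center differs
  from the fixed point \<open>P + L *\<^sub>R w\<close> of the similarity by exactly
  \<open>(L / m ^ i) *\<^sub>R R\<^sup>i w\<close> (lemma \<open>spiral_center_closed_form\<close>). Since \<open>R\<close> is an
  isometry and \<open>m > 1\<close>, this difference tends to zero, so the pole is \<open>P + L *\<^sub>R w\<close>, and solving
  the equation for \<open>w\<close> gives the stated coordinates.\<close>

text \<open>The clockwise rotation of the plane by a right angle.\<close>

definition quarter_turn :: "real \<times> real \<Rightarrow> real \<times> real" where
  "quarter_turn v = (snd v, - fst v)"

lemma quarter_turn_Pair [simp]: "quarter_turn (x, y) = (y, - x)"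
  by (simp add: quarter_turn_def)

lemma norm_quarter_turn_funpow: "norm ((quarter_turn ^^ n) v) = norm v"
  by (induction n) (simp_all add: quarter_turn_def norm_prod_def add.commute)

lemma linear_quarter_turn_funpow: "linear (quarter_turn ^^ n)"
proof -
  have "linear quarter_turn"
    by (rule linearI) (simp_all add: quarter_turn_def prod_eq_iff)
  then show ?thesis
    by (induction n) (auto intro: linear_compose simp: linear_id[unfolded id_def] id_def)
qed

lemma quarter_turn_funpow_mod_4: "(quarter_turn ^^ (n mod 4)) v = (quarter_turn ^^ n) v"
proof -
  have "(quarter_turn ^^ 4) v = v" for v
    by (cases v) (simp add: numeral_eq_Suc)
  then show ?thesis
    by (rule funpow_mod_eq)
qed

text \<open>The step from the center of a unit square to the center of its successor, for the placement
  used at indices divisible by 4.\<close>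

definition unit_step :: "real \<Rightarrow> real \<times> real" where
  "unit_step m = (1 / 2 + 1 / (2 * m), 1 / 2 - 1 / (2 * m))"

text \<open>The vector from the center of a unit square to the pole, for the same placement.\<close>

definition pole_offset :: "real \<Rightarrow> real \<times> real" where
  "pole_offset m = (1 / 2 + (m - 1) / (m\<^sup>2 + 1), 1 / 2 - (m + 1) / (m\<^sup>2 + 1))"

lemma pole_offset_eq:
  assumes "m \<noteq> 0"
  shows "pole_offset m = unit_step m + (1 / m) *\<^sub>R quarter_turn (pole_offset m)"
proof -
  have "m\<^sup>2 + 1 \<noteq> 0"
    using zero_le_power2[of m] by linarith
  define p q c where "p = (m - 1) / (m\<^sup>2 + 1)" and "q = (m + 1) / (m\<^sup>2 + 1)" and "c = 1 / m"
  have "p = c - c * q" "q = c + c * p"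
    unfolding p_def q_def c_def using assms \<open>m\<^sup>2 + 1 \<noteq> 0\<close>
    by (simp_all add: divide_simps) (simp_all add: algebra_simps power2_eq_square)
  then have "1 / 2 + p = 1 / 2 + c / 2 + c * (1 / 2 - q)"
    and "1 / 2 - q = 1 / 2 - c / 2 + c * - (1 / 2 + p)"
    by (simp_all only: right_diff_distrib distrib_left mult_minus_right)
  moreover have "pole_offset m = (1 / 2 + p, 1 / 2 - q)"
    and "unit_step m = (1 / 2 + c / 2, 1 / 2 - c / 2)"
    by (simp_all add: pole_offset_def unit_step_def p_def q_def c_def)
  ultimately show ?thesis
    by (simp only: quarter_turn_Pair scaleR_Pair add_Pair real_scaleR_def c_def)
qed

text \<open>The four cases of the recursion are the four powers of the quarter turn.\<close>

lemma spiral_center_Suc: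
  "spiral_center m L P (Suc i) =
     spiral_center m L P i + (L / m ^ i) *\<^sub>R (quarter_turn ^^ i) (unit_step m)"
proof -
  have "i mod 4 = 0 \<or> i mod 4 = 1 \<or> i mod 4 = 2 \<or> i mod 4 = 3"
    by linarith
  moreover have "(quarter_turn ^^ 2) v = - v" "(quarter_turn ^^ 3) v = - quarter_turn v" for v
    by (simp_all add: quarter_turn_def numeral_2_eq_2 numeral_3_eq_3 prod_eq_iff)
  ultimately have "spiral_center m L P (Suc i) =
      spiral_center m L P i + (L / m ^ i) *\<^sub>R (quarter_turn ^^ (i mod 4)) (unit_step m)"
    by (elim disjE)
      (simp_all add: Let_def spiral_side_def unit_step_def prod_eq_iff
        distrib_left right_diff_distrib)
  then show ?thesis
    by (simp only: quarter_turn_funpow_mod_4)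
qed

lemma spiral_center_closed_form:
  assumes "m \<noteq> 0"
  shows "spiral_center m L P i =
    P + L *\<^sub>R pole_offset m - (L / m ^ i) *\<^sub>R (quarter_turn ^^ i) (pole_offset m)"
proof (induction i)
  case 0
  show ?case by simp
next
  case (Suc i)
  let ?R = "quarter_turn ^^ i"
  have "?R (pole_offset m) = ?R (unit_step m + (1 / m) *\<^sub>R quarter_turn (pole_offset m))"
    using pole_offset_eq[OF assms] by simp
  also have "\<dots> = ?R (unit_step m) + (1 / m) *\<^sub>R (quarter_turn ^^ Suc i) (pole_offset m)"
    by (simp add: linear_add[OF linear_quarter_turn_funpow]
        linear_cmul[OF linear_quarter_turn_funpow] funpow_swap1)
  finally have step: "?R (pole_offset m) =
      ?R (unit_step m) + (1 / m) *\<^sub>R (quarter_turn ^^ Suc i) (pole_offset m)" .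
  have "(L / m ^ i) *\<^sub>R ?R (pole_offset m) =
      (L / m ^ i) *\<^sub>R ?R (unit_step m)
      + (L / m ^ Suc i) *\<^sub>R (quarter_turn ^^ Suc i) (pole_offset m)"
    by (subst step) (simp add: scaleR_add_right mult.commute del: funpow.simps)
  then show ?case
    unfolding spiral_center_Suc Suc.IH by (simp del: funpow.simps)
qed

lemma spiral_center_tendsto:
  assumes "m > 1"
  shows "spiral_center m L P \<longlonglongrightarrow> P + L *\<^sub>R pole_offset m"
proof -
  let ?d = "\<lambda>i. (L / m ^ i) *\<^sub>R (quarter_turn ^^ i) (pole_offset m)"
  have "(\<lambda>i. inverse m ^ i) \<longlonglongrightarrow> 0"
    using assms by (intro LIMSEQ_power_zero) (simp add: inverse_less_1_iff)
  then have "(\<lambda>i. \<bar>L\<bar> * norm (pole_offset m) * inverse m ^ i) \<longlonglongrightarrow> 0"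
    by (rule tendsto_mult_right_zero)
  moreover have "norm (?d i) = \<bar>L\<bar> * norm (pole_offset m) * inverse m ^ i" for i
    using assms by (simp add: norm_quarter_turn_funpow power_inverse field_simps)
  ultimately have "?d \<longlonglongrightarrow> 0"
    by (simp add: tendsto_norm_zero_iff[symmetric, of ?d])
  then have "(\<lambda>i. P + L *\<^sub>R pole_offset m - ?d i) \<longlonglongrightarrow> P + L *\<^sub>R pole_offset m - 0"
    by (intro tendsto_diff tendsto_const)
  moreover have "spiral_center m L P = (\<lambda>i. P + L *\<^sub>R pole_offset m - ?d i)"
    using assms by (auto simp: fun_eq_iff intro: spiral_center_closed_form)
  ultimately show ?thesis
    by simp
qed

theorem theorem2p3:
  fixes m L X0 Y0 :: real
  assumes "m > 1" and "L > 0"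
  shows "convergent (\<lambda>i. center (spiral m L (X0, Y0) i)) \<and>
    fst (pole (spiral m L (X0, Y0))) =
      fst (upper_right (spiral m L (X0, Y0) 0)) + L * ((m - 1) / (m\<^sup>2 + 1)) \<and>
    fst (pole (spiral m L (X0, Y0))) =
      fst (lower_right (spiral m L (X0, Y0) 0)) + L * ((m - 1) / (m\<^sup>2 + 1)) \<and>
    snd (pole (spiral m L (X0, Y0))) =
      snd (upper_right (spiral m L (X0, Y0) 0)) - L * ((m + 1) / (m\<^sup>2 + 1)) \<and>
    snd (pole (spiral m L (X0, Y0))) =
      snd (lower_right (spiral m L (X0, Y0) 0)) + L * (m * (m - 1) / (m\<^sup>2 + 1))"
proof -
  have lim: "(\<lambda>i. center (spiral m L (X0, Y0) i)) \<longlonglongrightarrow> (X0, Y0) + L *\<^sub>R pole_offset m"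
    using spiral_center_tendsto[OF assms(1)] by (simp add: spiral_def)
  have pole: "pole (spiral m L (X0, Y0)) = (X0, Y0) + L *\<^sub>R pole_offset m"
    unfolding pole_def by (rule limI[OF lim])
  have "m\<^sup>2 + 1 \<noteq> 0"
    using zero_le_power2[of m] by linarith
  then have lower: "m * (m - 1) / (m\<^sup>2 + 1) = 1 - (m + 1) / (m\<^sup>2 + 1)"
    by (simp add: field_simps power2_eq_square)
  show ?thesis
    unfolding pole lower using convergentI[OF lim]
    by (simp add: pole_offset_def upper_right_def lower_right_def spiral_def spiral_side_def
        algebra_simps)
qed

end
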